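(* Let $\rho,t>0$ and $\alpha>0$ with $\alpha^{-1}>\rho\lambda_{\max}(B^TB)$. The (Chambolle–Pock) primal algorithmic map $\mathrm{Prim}_t$ that sends $(z,\lambda)$, $z=(u,v)$, to $z^+=(u^+,v^+)$ defined by $$u^+=\operatorname{argmin}_{\xi_1}\left\{f(\xi_1)+\langle\lambda,\xi_1+Bv-b\rangle+\frac{\rho_t}{2}\|\xi_1+Bv-b\|^2\right\},$$ $$v^+=\operatorname{argmin}_{\xi_2}\left\{g(\xi_2)+\langle\lambda,u^++B\xi_2-b\rangle+\rho_t\langle u^++Bv-b,B\xi_2\rangle+\frac{\tau_t}{2\alpha}\|\xi_2-v\|^2\right\}$$ is nice (block version, see the context) with $\delta=1-\rho\alpha\lambda_{\max}(B^TB)$, $P_1=Q_1=0$, $P_2=(1/\alpha)I_q$ and $Q_2=0$.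
   Context: **Problem.** Let $f:\mathbb R^p\to(-\infty,+\infty]$ and $g:\mathbb R^q\to(-\infty,+\infty]$ be proper, lower semicontinuous and convex, with $g$ moreover $\sigma$-strongly convex, $\sigma\ge0$ ($\sigma=0$ means merely convex); let $B:\mathbb R^q\to\mathbb R^p$ be linear and $b\in\mathbb R^p$ (so $m=p$). For $z=(u,v)\in\mathbb R^p\times\mathbb R^q=\mathbb R^n$ put $\Psi(z)=f(u)+g(v)$, $\mathcal A z=u+Bv$, $\mathcal F=\{z:\mathcal A z=b\}$; the problem is $\min\{\Psi(z):\mathcal A z=b\}$. The augmented Lagrangian is $\mathcal L_\rho(z,y)=\Psi(z)+\langle y,\mathcal A z-b\rangle+\frac\rho2\|\mathcal A z-b\|^2$. Standing assumption: the Lagrangian $\mathcal L_0$ has a saddle point. **Notation.** $\mathbb S_+^d$ is the set of $d\times d$ symmetric positive semidefinite matrices; for $P\in\mathbb S_+^d$, $\|u\|_P=\sqrt{\langle u,Pu\rangle}$ and $\Delta_P(u,v,w)=\frac12(\|u-v\|_P^2-\|u-w\|_P^2)$. $\lambda_{\max}$ is the largest eigenvalue. **Nice primal algorithmic map (block version).** Given $\rho,t>0$, let $\tau_t=1,\rho_t=\rho$ if $\sigma=0$, and $\tau_t=t,\rho_t=\rho t$ if $\sigma>0$. A (possibly set-valued) map $\mathrm{Prim}_t$ on $\mathbb R^n\times\mathbb R^m$ with values in $\mathbb R^n$ is nice with $\delta\in(0,1]$, $P_1,Q_1\in\mathbb S_+^p$, $P_2,Q_2\in\mathbb S_+^q$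 if for all $(z,\lambda)$ with $z=(u,v)$, all $z^+=(u^+,v^+)\in\mathrm{Prim}_t(z,\lambda)$ and all $\xi=(\xi_1,\xi_2)\in\mathcal F$, $$\mathcal L_{\rho_t}(z^+,\lambda)-\mathcal L_{\rho_t}(\xi,\lambda)\le\frac1t\Delta_{P_1}(\xi_1,u,u^+)-\frac1{2t}\|u^+-u\|_{Q_1}^2+\tau_t\Delta_{P_2}(\xi_2,v,v^+)-\frac{\tau_t}2\|v^+-v\|_{Q_2}^2-\frac\sigma2\|\xi_2-v^+\|^2-\frac{\delta\rho_t}2\|\mathcal A z^+-b\|^2.$$ *)

theory Defs
  imports "HOL-Analysis.Analysis"
begin

definition proper_ereal :: "('a \<Rightarrow> ereal) \<Rightarrow> bool" where
  "proper_ereal h \<longleftrightarrow> (\<forall>x. h x \<noteq> -\<infinity>) \<and> (\<exists>x. h x \<noteq> \<infinity>)"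

definition lsc_ereal :: "('a::topological_space \<Rightarrow> ereal) \<Rightarrow> bool" where
  "lsc_ereal h \<longleftrightarrow> (\<forall>x. h x \<le> Liminf (at x) h)"

(* Only used for functions that never take the value -\<infinity>, so that the sums on the
   right-hand sides of the next two definitions are the usual ones. *)
definition convex_ereal :: "('a::real_vector \<Rightarrow> ereal) \<Rightarrow> bool" where
  "convex_ereal h \<longleftrightarrow>
    (\<forall>x y s. 0 < s \<and> s < 1 \<longrightarrow>
      h (s *\<^sub>R x + (1 - s) *\<^sub>R y) \<le> ereal s * h x + ereal (1 - s) * h y)"

definition strongly_convex_ereal :: "real \<Rightarrow> ('a::real_normed_vector \<Rightarrow> ereal) \<Rightarrow> bool" where
  "strongly_convex_ereal \<sigma> h \<longleftrightarrow>
    (\<forall>x y s. 0 < s \<and> s < 1 \<longrightarrow>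
      h (s *\<^sub>R x + (1 - s) *\<^sub>R y)
        \<le> ereal s * h x + ereal (1 - s) * h y
           - ereal (\<sigma> / 2 * s * (1 - s) * (norm (x - y))\<^sup>2))"

definition psd :: "real^'d^'d \<Rightarrow> bool" where
  "psd P \<longleftrightarrow> transpose P = P \<and> (\<forall>x. 0 \<le> x \<bullet> (P *v x))"

definition norm_mat :: "real^'d^'d \<Rightarrow> real^'d \<Rightarrow> real" where
  "norm_mat P x = sqrt (x \<bullet> (P *v x))"

definition Delta :: "real^'d^'d \<Rightarrow> real^'d \<Rightarrow> real^'d \<Rightarrow> real^'d \<Rightarrow> real" where
  "Delta P u v w = ((norm_mat P (u - v))\<^sup>2 - (norm_mat P (u - w))\<^sup>2) / 2"

(* Meaningful for matrices having a largest real eigenvalue, e.g. all symmetric ones. *)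
definition lambda_max :: "real^'d^'d \<Rightarrow> real" where
  "lambda_max M = (GREATEST c. \<exists>x. x \<noteq> 0 \<and> M *v x = c *\<^sub>R x)"

definition Psi :: "(real^'p \<Rightarrow> ereal) \<Rightarrow> (real^'q \<Rightarrow> ereal) \<Rightarrow> (real^'p) \<times> (real^'q) \<Rightarrow> ereal" where
  "Psi f g z = f (fst z) + g (snd z)"

definition Aop :: "real^'q^'p \<Rightarrow> (real^'p) \<times> (real^'q) \<Rightarrow> real^'p" where
  "Aop B z = fst z + B *v snd z"

definition feasible :: "real^'q^'p \<Rightarrow> real^'p \<Rightarrow> ((real^'p) \<times> (real^'q)) set" where
  "feasible B b = {z. Aop B z = b}"

definition aug_lagrangian ::
  "(real^'p \<Rightarrow> ereal) \<Rightarrow> (real^'q \<Rightarrow> ereal) \<Rightarrow> real^'q^'p \<Rightarrow> real^'p \<Rightarrow> real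
    \<Rightarrow> (real^'p) \<times> (real^'q) \<Rightarrow> real^'p \<Rightarrow> ereal" where
  "aug_lagrangian f g B b r z y =
    Psi f g z + ereal (y \<bullet> (Aop B z - b) + r / 2 * (norm (Aop B z - b))\<^sup>2)"

definition saddle_point :: "('z \<Rightarrow> 'y \<Rightarrow> ereal) \<Rightarrow> 'z \<Rightarrow> 'y \<Rightarrow> bool" where
  "saddle_point L z y \<longleftrightarrow> (\<forall>z' y'. L z y' \<le> L z y \<and> L z y \<le> L z' y)"

definition tau_t :: "real \<Rightarrow> real \<Rightarrow> real" where
  "tau_t \<sigma> t = (if \<sigma> = 0 then 1 else t)"

definition rho_t :: "real \<Rightarrow> real \<Rightarrow> real \<Rightarrow> real" where
  "rho_t \<sigma> \<rho> t = (if \<sigma> = 0 then \<rho> else \<rho> * t)"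

(* The multiplier lambda is written y throughout. In type ereal a difference c - \<infinity> is
   -\<infinity> for finite c, but \<infinity> - \<infinity> = \<infinity>: an infinite value of Psi at the reference
   point makes the inequality trivial only if Psi is finite at the new iterate. *)
definition nice_primal_map ::
  "(real^'p \<Rightarrow> ereal) \<Rightarrow> (real^'q \<Rightarrow> ereal) \<Rightarrow> real^'q^'p \<Rightarrow> real^'p \<Rightarrow> real \<Rightarrow> real \<Rightarrow> real
    \<Rightarrow> ((real^'p) \<times> (real^'q) \<Rightarrow> real^'p \<Rightarrow> ((real^'p) \<times> (real^'q)) set)
    \<Rightarrow> real \<Rightarrow> real^'p^'p \<Rightarrow> real^'p^'p \<Rightarrow> real^'q^'q \<Rightarrow> real^'q^'q \<Rightarrow> bool" where
  "nice_primal_map f g B b \<sigma> \<rho> t Prim \<delta> P1 Q1 P2 Q2 \<longleftrightarrow>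
    0 < \<delta> \<and> \<delta> \<le> 1 \<and> psd P1 \<and> psd Q1 \<and> psd P2 \<and> psd Q2 \<and>
    (\<forall>u v y u' v' \<xi>1 \<xi>2.
      (u', v') \<in> Prim (u, v) y \<and> (\<xi>1, \<xi>2) \<in> feasible B b \<longrightarrow>
      aug_lagrangian f g B b (rho_t \<sigma> \<rho> t) (u', v') y
        - aug_lagrangian f g B b (rho_t \<sigma> \<rho> t) (\<xi>1, \<xi>2) y
      \<le> ereal (1 / t * Delta P1 \<xi>1 u u'
               - 1 / (2 * t) * (norm_mat Q1 (u' - u))\<^sup>2
               + tau_t \<sigma> t * Delta P2 \<xi>2 v v'
               - tau_t \<sigma> t / 2 * (norm_mat Q2 (v' - v))\<^sup>2
               - \<sigma> / 2 * (norm (\<xi>2 - v'))\<^sup>2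
               - \<delta> * rho_t \<sigma> \<rho> t / 2 * (norm (Aop B (u', v') - b))\<^sup>2))"

definition chambolle_pock ::
  "(real^'p \<Rightarrow> ereal) \<Rightarrow> (real^'q \<Rightarrow> ereal) \<Rightarrow> real^'q^'p \<Rightarrow> real^'p \<Rightarrow> real \<Rightarrow> real \<Rightarrow> real \<Rightarrow> real
    \<Rightarrow> (real^'p) \<times> (real^'q) \<Rightarrow> real^'p \<Rightarrow> ((real^'p) \<times> (real^'q)) set" where
  "chambolle_pock f g B b \<sigma> \<rho> t \<alpha> z y =
    {(u', v').
      is_arg_min
        (\<lambda>\<xi>1. f \<xi>1 + ereal (y \<bullet> (\<xi>1 + B *v snd z - b)
                      + rho_t \<sigma> \<rho> t / 2 * (norm (\<xi>1 + B *v snd z - b))\<^sup>2))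
        (\<lambda>_. True) u' \<and>
      is_arg_min
        (\<lambda>\<xi>2. g \<xi>2 + ereal (y \<bullet> (u' + B *v \<xi>2 - b)
                      + rho_t \<sigma> \<rho> t * ((u' + B *v snd z - b) \<bullet> (B *v \<xi>2))
                      + tau_t \<sigma> t / (2 * \<alpha>) * (norm (\<xi>2 - snd z))\<^sup>2))
        (\<lambda>_. True) v'}"

end

theory Submission
  imports Defs
begin

text \<open>Each of the two subproblems minimises a proper, lower semicontinuous, convex function plus a
  quadratic term with positive curvature, hence a strongly convex function. Such a function has
  exactly one minimiser (\<open>strongly_convex_unique_argmin\<close>), and with modulus \<open>\<mu>\<close> its value at
  any \<open>y\<close> exceeds the minimum by at least \<open>\<mu> / 2\<close> times the squared distance of \<open>y\<close> from the
  minimiser (\<open>strongly_convex_argmin_growth\<close>). The first fact makes the map single-valued.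

  The second fact, applied to the \<open>u\<close>-step at \<open>\<xi>1\<close> and to the \<open>v\<close>-step at \<open>\<xi>2\<close> and added up,
  gives the inequality of a nice map up to terms in the penalty parameter \<open>r = \<rho> * \<tau>\<close>, where
  \<open>\<rho>\<close> and \<open>\<tau>\<close> are the unscaled penalty parameter and the proximal scaling of the \<open>v\<close>-step.
  Write \<open>e = u' + B v - b\<close> for the intermediate residual and \<open>d = B (v' - v)\<close>, so that
  \<open>e + d\<close> is the new residual. Since \<open>\<xi>\<close> is feasible, those penalty terms lose their dependence
  on \<open>\<xi>\<close> (\<open>penalty_terms_collapse\<close>), and what remains to be shown is
  \<open>\<delta> \<parallel>e + d\<parallel>\<^sup>2 \<le> \<parallel>e\<parallel>\<^sup>2 - \<parallel>d\<parallel>\<^sup>2 + \<parallel>v' - v\<parallel>\<^sup>2 / (\<rho> * \<alpha>)\<close>.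
  Let \<open>l\<close> be the largest eigenvalue of the Gram matrix \<open>transpose B ** B\<close>. As a maximum of
  Rayleigh quotients it satisfies \<open>\<parallel>d\<parallel>\<^sup>2 \<le> l \<parallel>v' - v\<parallel>\<^sup>2\<close>
  (\<open>norm_matrix_vector_le_lambda_max\<close>), and then the choice \<open>\<delta> = 1 - \<rho> * \<alpha> * l\<close> makes the
  estimate a completed square (\<open>residual_estimate\<close>).\<close>

section \<open>Lower semicontinuous functions\<close>

lemma lsc_erealD:
  assumes "lsc_ereal h" and "c < h x"
  shows "eventually (\<lambda>y. c < h y) (at x)"
  using assms unfolding lsc_ereal_def le_Liminf_iff by blast

lemma lsc_ereal_open_superlevel:
  assumes "lsc_ereal h"
  shows "open {x. c < h x}"
proof (rule Topological_Spaces.openI)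
  fix x assume "x \<in> {x. c < h x}"
  then have "eventually (\<lambda>y. c < h y) (nhds x)"
    using lsc_erealD[OF assms] by (simp add: eventually_nhds_conv_at)
  then show "\<exists>T. open T \<and> x \<in> T \<and> T \<subseteq> {x. c < h x}"
    unfolding eventually_nhds by auto
qed

text \<open>If no point of \<open>S\<close> were a minimiser, the open sets \<open>{x. h y < h x}\<close> with \<open>y \<in> S\<close> would
  cover \<open>S\<close>; among the finitely many \<open>y\<close> of a finite subcover, the one with the least value
  lies in none of the chosen sets.\<close>

lemma lsc_ereal_attains_min:
  assumes "lsc_ereal h" and "compact S" and "S \<noteq> {}"
  obtains x where "x \<in> S" and "\<And>y. y \<in> S \<Longrightarrow> h x \<le> h y"
proof -
  have "\<exists>x\<in>S. \<forall>y\<in>S. h x \<le> h y"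
  proof (rule ccontr)
    assume "\<not> ?thesis"
    then have "S \<subseteq> (\<Union>y\<in>S. {x. h y < h x})"
      by (force simp: not_le)
    then obtain C where C: "C \<subseteq> S" "finite C" "S \<subseteq> (\<Union>y\<in>C. {x. h y < h x})"
      using compactE_image[OF \<open>compact S\<close>] lsc_ereal_open_superlevel[OF assms(1)] by metis
    from C(3) assms(3) have "C \<noteq> {}" by auto
    with C(2) obtain y where y: "y \<in> C" "\<forall>z\<in>C. h y \<le> h z"
      by (metis arg_min_if_finite(1) arg_min_least)
    with C show False by (fastforce simp: not_le)
  qed
  with that show thesis by blast
qed

lemma lsc_ereal_add_continuous:
  fixes h :: "'a::topological_space \<Rightarrow> ereal"
  assumes "lsc_ereal h" and "continuous_on UNIV \<phi>"
  shows "lsc_ereal (\<lambda>x. h x + ereal (\<phi> x))"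
  unfolding lsc_ereal_def le_Liminf_iff
proof (intro allI impI)
  fix x c assume c: "c < h x + ereal (\<phi> x)"
  show "eventually (\<lambda>y. c < h y + ereal (\<phi> y)) (at x)"
  proof -
    have "c - ereal (\<phi> x) < h x"
      using c by (cases c; cases "h x") auto
    then obtain d where "c - ereal (\<phi> x) < d" "d < h x"
      using dense by blast
    then obtain e where e: "c - ereal (\<phi> x) < ereal e" "ereal e < h x"
      by (cases d) auto
    have "(\<phi> \<longlongrightarrow> \<phi> x) (at x)"
      using assms(2) by (simp add: continuous_on_def)
    moreover have "c - ereal e < ereal (\<phi> x)"
      using e(1) by (cases c) auto
    ultimately have "eventually (\<lambda>y. c - ereal e < ereal (\<phi> y)) (at x)"
      using order_tendstoD(1)[OF tendsto_ereal] by blast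
    moreover have "eventually (\<lambda>y. ereal e < h y) (at x)"
      using lsc_erealD[OF assms(1) e(2)] .
    ultimately show ?thesis
    proof eventually_elim
      case (elim y)
      then show ?case by (cases c; cases "h y") auto
    qed
  qed
qed

section \<open>Strongly convex functions\<close>

lemma convex_imp_strongly_convex_ereal_0:
  "convex_ereal h \<Longrightarrow> strongly_convex_ereal 0 h"
  unfolding convex_ereal_def strongly_convex_ereal_def by simp

lemma strongly_convex_ereal_add:
  fixes h :: "'a::real_normed_vector \<Rightarrow> ereal"
  assumes h: "strongly_convex_ereal \<sigma> h" "\<And>x. h x \<noteq> -\<infinity>"
    and \<phi>: "strongly_convex_ereal c (\<lambda>x. ereal (\<phi> x))"
  shows "strongly_convex_ereal (\<sigma> + c) (\<lambda>x. h x + ereal (\<phi> x))"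
  unfolding strongly_convex_ereal_def
proof (intro allI impI)
  fix x y :: 'a and s :: real assume s: "0 < s \<and> s < 1"
  let ?z = "s *\<^sub>R x + (1 - s) *\<^sub>R y"
  show "h ?z + ereal (\<phi> ?z) \<le> ereal s * (h x + ereal (\<phi> x)) + ereal (1 - s) * (h y + ereal (\<phi> y))
      - ereal ((\<sigma> + c) / 2 * s * (1 - s) * (norm (x - y))\<^sup>2)"
  proof (cases "h x = \<infinity> \<or> h y = \<infinity>")
    case True
    then show ?thesis using s h(2)[of x] h(2)[of y] by (cases "h x"; cases "h y") auto
  next
    case False
    then obtain a b where ab: "h x = ereal a" "h y = ereal b"
      using h(2)[of x] h(2)[of y] by (cases "h x"; cases "h y") auto
    have "h ?z \<le> ereal (s * a + (1 - s) * b - \<sigma> / 2 * s * (1 - s) * (norm (x - y))\<^sup>2)"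
      using h(1)[unfolded strongly_convex_ereal_def, rule_format, OF s, of x y] ab by simp
    moreover have "\<phi> ?z \<le> s * \<phi> x + (1 - s) * \<phi> y - c / 2 * s * (1 - s) * (norm (x - y))\<^sup>2"
      using \<phi> s unfolding strongly_convex_ereal_def by simp
    ultimately show ?thesis
      unfolding ab by (cases "h ?z") (auto simp: algebra_simps add_divide_distrib)
  qed
qed

lemma strongly_convex_affine_plus_square:
  fixes w :: "'a::real_inner"
  assumes "\<And>x y s. L (s *\<^sub>R x + (1 - s) *\<^sub>R y) = s * L x + (1 - s) * L y"
  shows "strongly_convex_ereal c (\<lambda>x. ereal (L x + c / 2 * (norm (x - w))\<^sup>2))"
proof -
  have eq: "(norm (s *\<^sub>R x + (1 - s) *\<^sub>R y - w))\<^sup>2 =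
      s * (norm (x - w))\<^sup>2 + (1 - s) * (norm (y - w))\<^sup>2 - s * (1 - s) * (norm (x - y))\<^sup>2"
    for x y s
    unfolding power2_norm_eq_inner by (simp add: inner_commute algebra_simps)
  show ?thesis
    unfolding strongly_convex_ereal_def
  proof (intro allI impI)
    fix x y and s :: real
    show "ereal (L (s *\<^sub>R x + (1 - s) *\<^sub>R y)
          + c / 2 * (norm (s *\<^sub>R x + (1 - s) *\<^sub>R y - w))\<^sup>2)
        \<le> ereal s * ereal (L x + c / 2 * (norm (x - w))\<^sup>2)
          + ereal (1 - s) * ereal (L y + c / 2 * (norm (y - w))\<^sup>2)
          - ereal (c / 2 * s * (1 - s) * (norm (x - y))\<^sup>2)"
      unfolding assms eq by (simp add: field_simps)
  qed
qed

text \<open>Along the segment from a minimiser \<open>x\<close> to \<open>y\<close>, strong convexity bounds the difference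
  \<open>H y - H x\<close> from below by \<open>(1 - s) * \<mu> / 2 * \<parallel>y - x\<parallel>\<^sup>2\<close>; then \<open>s\<close> tends to \<open>0\<close>.\<close>

lemma strongly_convex_argmin_growth:
  assumes H: "strongly_convex_ereal \<mu> H" "proper_ereal H"
    and x: "is_arg_min H (\<lambda>_. True) x"
  shows "H x + ereal (\<mu> / 2 * (norm (y - x))\<^sup>2) \<le> H y"
proof (cases "H y = \<infinity>")
  case False
  have min: "H x \<le> H z" for z
    using x by (simp add: is_arg_min_linorder)
  obtain a k where ak: "H x = ereal a" "H y = ereal k"
    using False H(2) min[of y] unfolding proper_ereal_def
    by (cases "H x"; cases "H y") auto
  have "\<mu> / 2 * (norm (y - x))\<^sup>2 \<le> k - a"
  proof (rule field_le_mult_one_interval)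
    fix z :: real assume z: "0 < z" "z < 1"
    have "H x \<le> H ((1 - z) *\<^sub>R y + z *\<^sub>R x)" by (rule min)
    also have "\<dots> \<le> ereal ((1 - z) * k + z * a - \<mu> / 2 * (1 - z) * z * (norm (y - x))\<^sup>2)"
      using H(1)[unfolded strongly_convex_ereal_def, rule_format, of "1 - z" y x] z ak by simp
    finally have "(1 - z) * (z * (\<mu> / 2 * (norm (y - x))\<^sup>2)) \<le> (1 - z) * (k - a)"
      unfolding ak by (simp add: algebra_simps)
    then show "z * (\<mu> / 2 * (norm (y - x))\<^sup>2) \<le> k - a"
      using z by simp
  qed
  then show ?thesis unfolding ak by simp
qed simp

text \<open>The function is bounded below on a unit ball around a point \<open>x0\<close> of its domain, by
  compactness. Convexity transports this bound outwards, where it degrades at most linearly,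
  whereas strong convexity adds a quadratic term; so outside a large ball the values
  are at least \<open>H x0\<close>, and the minimum over that ball is global.\<close>

lemma strongly_convex_has_argmin:
  fixes H :: "'a::euclidean_space \<Rightarrow> ereal"
  assumes H: "strongly_convex_ereal \<mu> H" "proper_ereal H" "lsc_ereal H" and \<mu>: "0 < \<mu>"
  obtains x where "is_arg_min H (\<lambda>_. True) x"
proof -
  obtain x0 h0 where h0: "H x0 = ereal h0"
    using H(2) unfolding proper_ereal_def by (metis ereal_cases)
  obtain x1 where x1: "\<And>y. y \<in> cball x0 1 \<Longrightarrow> H x1 \<le> H y"
    using lsc_ereal_attains_min[OF H(3), of "cball x0 1"] by auto
  obtain m where m: "H x1 = ereal m" "m \<le> h0"
    using x1[of x0] h0 H(2) unfolding proper_ereal_def by (cases "H x1") auto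
  define R where "R = 1 + 2 * (h0 - m) / \<mu>"
  have R: "1 \<le> R" using m(2) \<mu> by (simp add: R_def)
  obtain x where x: "\<And>y. y \<in> cball x0 R \<Longrightarrow> H x \<le> H y"
    using lsc_ereal_attains_min[OF H(3), of "cball x0 R"] R by auto
  have far: "H x0 \<le> H y" if y: "y \<notin> cball x0 R" for y
  proof (rule ccontr)
    assume "\<not> H x0 \<le> H y"
    then obtain k where k: "H y = ereal k" "k < h0"
      using h0 H(2) unfolding proper_ereal_def by (cases "H y") auto
    define d where "d = norm (y - x0)"
    have d: "R < d" using y by (simp add: d_def dist_norm norm_minus_commute)
    have d1: "1 < d" using d R by simp
    \<comment> \<open>the point where the segment from \<open>x0\<close> to \<open>y\<close> leaves the unit ball\<close>
    let ?z = "(1 / d) *\<^sub>R y + (1 - 1 / d) *\<^sub>R x0"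
    have "?z - x0 = (1 / d) *\<^sub>R (y - x0)" by (simp add: algebra_simps)
    then have "norm (?z - x0) = 1" using d1 by (simp add: d_def[symmetric])
    then have "?z \<in> cball x0 1" by (simp add: dist_norm norm_minus_commute)
    then have "H x1 \<le> H ?z" by (rule x1)
    also have "\<dots> \<le> ereal (1 / d * k + (1 - 1 / d) * h0 - \<mu> / 2 * (1 / d) * (1 - 1 / d) * d\<^sup>2)"
      using H(1)[unfolded strongly_convex_ereal_def, rule_format, of "1 / d" y x0] d1 k h0
      by (simp add: d_def[symmetric])
    finally have "m \<le> 1 / d * k + (1 - 1 / d) * h0 - \<mu> / 2 * (1 / d) * (1 - 1 / d) * d\<^sup>2"
      using m by simp
    also have "\<dots> = h0 - (h0 - k) / d - \<mu> / 2 * (d - 1)"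
      using d1 by (simp add: field_simps power2_eq_square)
    also have "\<dots> < h0 - \<mu> / 2 * (d - 1)"
      using k(2) d1 by simp
    finally have "\<mu> * (d - 1) < 2 * (h0 - m)" by (simp add: field_simps)
    then have "d < R" using \<mu> by (simp add: R_def field_simps)
    with d show False by simp
  qed
  have "H x \<le> H y" for y
    using x[of y] x[of x0] far[of y] R by (cases "y \<in> cball x0 R") auto
  then have "is_arg_min H (\<lambda>_. True) x" by (simp add: is_arg_min_linorder)
  then show thesis by (rule that)
qed

lemma strongly_convex_unique_argmin:
  fixes H :: "'a::euclidean_space \<Rightarrow> ereal"
  assumes H: "strongly_convex_ereal \<mu> H" "proper_ereal H" "lsc_ereal H" and \<mu>: "0 < \<mu>"
  shows "\<exists>!x. is_arg_min H (\<lambda>_. True) x"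
proof -
  obtain x where x: "is_arg_min H (\<lambda>_. True) x"
    using strongly_convex_has_argmin[OF assms] .
  moreover have "y = x" if y: "is_arg_min H (\<lambda>_. True) y" for y
  proof -
    have "H y \<le> H x" "H x \<le> H y" "H x \<noteq> \<infinity>" "H x \<noteq> -\<infinity>"
      using x y H(2) unfolding proper_ereal_def is_arg_min_linorder
      by (auto simp: top.extremum_unique)
    moreover have "H x + ereal (\<mu> / 2 * (norm (y - x))\<^sup>2) \<le> H y"
      by (rule strongly_convex_argmin_growth[OF H(1,2) x])
    ultimately have "\<mu> / 2 * (norm (y - x))\<^sup>2 \<le> 0"
      by (cases "H x"; cases "H y") auto
    then show ?thesis using \<mu> by (simp add: mult_le_0_iff)
  qed
  ultimately show ?thesis by blast
qed

text \<open>Both proximal steps are instances: \<open>L\<close> collects the affine terms and \<open>c\<close> is the curvature of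
  the squared norm.\<close>

lemma argmin_penalised:
  fixes h :: "'a::euclidean_space \<Rightarrow> ereal" and L :: "'a \<Rightarrow> real"
  assumes h: "proper_ereal h" "lsc_ereal h" "strongly_convex_ereal \<sigma> h" and "0 \<le> \<sigma>" "0 < c"
    and L: "\<And>x y s. L (s *\<^sub>R x + (1 - s) *\<^sub>R y) = s * L x + (1 - s) * L y"
      "continuous_on UNIV L"
    and H: "H = (\<lambda>x. h x + ereal (L x + c / 2 * (norm (x - w))\<^sup>2))"
  shows "\<exists>!x. is_arg_min H (\<lambda>_. True) x"
    and "is_arg_min H (\<lambda>_. True) x \<Longrightarrow> H x + ereal ((\<sigma> + c) / 2 * (norm (y - x))\<^sup>2) \<le> H y"
    and "is_arg_min H (\<lambda>_. True) x \<Longrightarrow> \<bar>h x\<bar> \<noteq> \<infinity>"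
proof -
  have sc: "strongly_convex_ereal (\<sigma> + c) H"
    unfolding H
    by (rule strongly_convex_ereal_add[OF h(3) _ strongly_convex_affine_plus_square[OF L(1)]])
      (use h(1) in \<open>auto simp: proper_ereal_def\<close>)
  have lsc: "lsc_ereal H"
    unfolding H by (rule lsc_ereal_add_continuous[OF h(2)]) (intro continuous_intros L(2))
  have pr: "proper_ereal H"
    using h(1) unfolding H proper_ereal_def by auto
  show "\<exists>!x. is_arg_min H (\<lambda>_. True) x"
    using strongly_convex_unique_argmin[OF sc pr lsc] assms(4,5) by simp
  show "H x + ereal ((\<sigma> + c) / 2 * (norm (y - x))\<^sup>2) \<le> H y" if "is_arg_min H (\<lambda>_. True) x"
    by (rule strongly_convex_argmin_growth[OF sc pr that])
  show "\<bar>h x\<bar> \<noteq> \<infinity>" if "is_arg_min H (\<lambda>_. True) x"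
    using that h(1) unfolding H proper_ereal_def is_arg_min_linorder
    by (cases "h x") fastforce+
qed

section \<open>The largest eigenvalue of a symmetric matrix\<close>

text \<open>A maximiser \<open>x0\<close> of the Rayleigh quotient over the unit sphere, with maximum \<open>c\<close>, is an
  eigenvector: \<open>Q x = c * (x \<bullet> x) - x \<bullet> (M *v x)\<close> is a nonnegative quadratic form vanishing
  at \<open>x0\<close>, so its gradient at \<open>x0\<close> vanishes. Conversely no eigenvalue exceeds \<open>c\<close>, so \<open>c\<close> is
  the largest one.\<close>

lemma quadratic_form_le_lambda_max:
  fixes M :: "real^'n^'n"
  assumes sym: "transpose M = M"
  shows "x \<bullet> (M *v x) \<le> lambda_max M * (norm x)\<^sup>2"
proof -
  have symD: "a \<bullet> (M *v d) = (M *v a) \<bullet> d" for a d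
    by (metis dot_lmul_matrix sym vector_transpose_matrix)
  have "continuous_on (sphere 0 1) (\<lambda>x. x \<bullet> (M *v x))"
    by (intro continuous_intros matrix_vector_mult_linear_continuous_on)
  moreover have "axis undefined 1 \<in> sphere (0::real^'n) 1" by simp
  ultimately obtain x0 where x0: "norm x0 = 1"
    and max: "\<And>x. norm x = 1 \<Longrightarrow> x \<bullet> (M *v x) \<le> x0 \<bullet> (M *v x0)"
    using continuous_attains_sup[of "sphere 0 1" "\<lambda>x. x \<bullet> (M *v x)"] compact_sphere
    by (metis empty_iff mem_sphere_0)
  define c where "c = x0 \<bullet> (M *v x0)"
  define Q where "Q x = c * (x \<bullet> x) - x \<bullet> (M *v x)" for x
  have Q0: "0 \<le> Q x" for x
  proof (cases "x = 0")
    case False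
    then have "(x /\<^sub>R norm x) \<bullet> (M *v (x /\<^sub>R norm x)) \<le> c"
      unfolding c_def by (intro max) simp
    then have "x \<bullet> (M *v x) / (norm x)\<^sup>2 \<le> c"
      by (simp add: matrix_vector_mult_scaleR power2_eq_square divide_inverse mult_ac)
    then show ?thesis
      using False by (simp add: Q_def field_simps power2_norm_eq_inner)
  qed (simp add: Q_def)
  define y where "y = c *\<^sub>R x0 - M *v x0"
  have Qe: "Q (x0 - e *\<^sub>R y) = e * (e * Q y - 2 * (y \<bullet> y))" for e
  proof -
    have "Q x0 = 0" using x0 by (simp add: Q_def c_def power2_norm_eq_inner[symmetric])
    have "Q (x0 - e *\<^sub>R y) = Q x0 - 2 * e * (c * (x0 \<bullet> y) - (M *v x0) \<bullet> y) + e * e * Q y"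
      unfolding Q_def using symD[of x0 y]
      by (simp add: matrix_vector_mult_diff_distrib matrix_vector_mult_scaleR algebra_simps
          inner_commute)
    also have "c * (x0 \<bullet> y) - (M *v x0) \<bullet> y = y \<bullet> y"
      by (simp add: y_def inner_diff_left)
    finally show ?thesis using \<open>Q x0 = 0\<close> by (simp add: algebra_simps)
  qed
  have "2 * (y \<bullet> y) \<le> 0"
  proof (rule field_le_epsilon)
    fix \<epsilon> :: real assume "0 < \<epsilon>"
    \<comment> \<open>adding 1 keeps the denominator positive also if \<open>Q y = 0\<close>\<close>
    define e where "e = \<epsilon> / (Q y + 1)"
    have e: "0 < e" "e * Q y \<le> \<epsilon>"
      using Q0[of y] \<open>0 < \<epsilon>\<close> by (auto simp: e_def field_simps)
    from Q0[of "x0 - e *\<^sub>R y"] e have "2 * (y \<bullet> y) \<le> e * Q y"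
      unfolding Qe by (simp add: zero_le_mult_iff)
    with e show "2 * (y \<bullet> y) \<le> 0 + \<epsilon>" by simp
  qed
  then have "y \<bullet> y = 0" using inner_ge_zero[of y] by linarith
  then have "y = 0" by simp
  then have eig: "M *v x0 = c *\<^sub>R x0" by (simp add: y_def)
  have "lambda_max M = c"
    unfolding lambda_max_def
  proof (rule Greatest_equality)
    show "\<exists>x. x \<noteq> 0 \<and> M *v x = c *\<^sub>R x" using eig x0 by (intro exI[of _ x0]) auto
    fix k assume "\<exists>x. x \<noteq> 0 \<and> M *v x = k *\<^sub>R x"
    then obtain x where "x \<noteq> 0" "M *v x = k *\<^sub>R x" by blast
    with Q0[of x] show "k \<le> c" by (simp add: Q_def)
  qed
  with Q0[of x] show ?thesis by (simp add: Q_def power2_norm_eq_inner)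
qed

lemma norm_matrix_vector_le_lambda_max:
  fixes B :: "real^'q^'p"
  shows "(norm (B *v x))\<^sup>2 \<le> lambda_max (transpose B ** B) * (norm x)\<^sup>2"
proof -
  have "(norm (B *v x))\<^sup>2 = x \<bullet> ((transpose B ** B) *v x)"
    by (simp add: power2_norm_eq_inner dot_lmul_matrix[symmetric] matrix_vector_mul_assoc[symmetric]
        inner_commute)
  also have "\<dots> \<le> lambda_max (transpose B ** B) * (norm x)\<^sup>2"
    by (rule quadratic_form_le_lambda_max) (simp add: matrix_transpose_mul)
  finally show ?thesis .
qed

lemma lambda_max_Gram_nonneg: "0 \<le> lambda_max (transpose B ** B)" for B :: "real^'q^'p"
proof -
  have "0 \<le> (norm (B *v axis undefined 1))\<^sup>2" by simp
  also have "\<dots> \<le> lambda_max (transpose B ** B) * (norm (axis undefined (1::real) :: real^'q))\<^sup>2"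
    by (rule norm_matrix_vector_le_lambda_max)
  finally show ?thesis by simp
qed

section \<open>The primal map of Chambolle and Pock\<close>

text \<open>For \<open>l > 0\<close> put \<open>s = k * l\<close>. The right-hand side exceeds the left-hand side by at least
  \<open>(norm (s *\<^sub>R r - (1 - s) *\<^sub>R d))\<^sup>2 / s\<close>, because \<open>w \<ge> (norm d)\<^sup>2 / l\<close>. For \<open>l = 0\<close> the
  vector \<open>d\<close> vanishes. The case of interest is \<open>k = \<rho> * \<alpha>\<close>, with \<open>r\<close> the intermediate
  residual.\<close>

lemma residual_estimate:
  fixes r d :: "'a::real_inner"
  assumes k: "0 < k" and l: "0 \<le> l" and w: "0 \<le> w" and d: "(norm d)\<^sup>2 \<le> l * w"
  shows "(1 - k * l) * (norm (r + d))\<^sup>2 \<le> (norm r)\<^sup>2 - (norm d)\<^sup>2 + w / k"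
proof (cases "l = 0")
  case True
  then have "d = 0" using d by simp
  then show ?thesis using True w k by simp
next
  case False
  define s where "s = k * l"
  have s: "0 < s" using False k l by (simp add: s_def)
  have "0 \<le> (norm (s *\<^sub>R r - (1 - s) *\<^sub>R d))\<^sup>2" by simp
  also have "\<dots> = s * (norm r)\<^sup>2 + (1 - s) * (norm d)\<^sup>2 - s * (1 - s) * (norm (r + d))\<^sup>2"
    unfolding power2_norm_eq_inner by (simp add: inner_commute algebra_simps)
  also have "\<dots> \<le> s * ((norm r)\<^sup>2 - (norm d)\<^sup>2 + w / k - (1 - s) * (norm (r + d))\<^sup>2)"
    using d k by (simp add: s_def algebra_simps)
  finally show ?thesis
    using s by (simp add: zero_le_mult_iff s_def)
qed

lemma norm_mat_zero: "norm_mat 0 x = 0"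
  by (simp add: norm_mat_def)

lemma norm_mat_scaled_id:
  assumes "0 \<le> c"
  shows "(norm_mat (c *\<^sub>R mat 1) x)\<^sup>2 = c * (norm x)\<^sup>2"
  using assms
  by (simp add: norm_mat_def scaleR_matrix_vector_assoc[symmetric] power2_norm_eq_inner)

lemma psd_scaled_id: "0 \<le> c \<Longrightarrow> psd (c *\<^sub>R mat 1)"
  by (simp add: psd_def transpose_scalar transpose_mat scaleR_matrix_vector_assoc[symmetric])

text \<open>On the left are the penalty terms left over from adding the growth inequalities of the two
  proximal steps at a feasible point \<open>(x, \<xi>)\<close>, divided by the penalty parameter. With
  \<open>e = u' + Bv - b\<close> and \<open>d = Bv' - Bv\<close> both sides equal \<open>- (e \<bullet> (e + d))\<close>; on the right
  the feasible point has disappeared.\<close>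

lemma penalty_terms_collapse:
  fixes x u' Bv Bv' B\<xi> b :: "'a::real_inner"
  assumes "x + B\<xi> = b"
  shows "((norm (x + Bv - b))\<^sup>2 - (norm (u' + Bv - b))\<^sup>2 - (norm (x - u'))\<^sup>2) / 2
      + (u' + Bv - b) \<bullet> (B\<xi> - Bv')
    = ((norm (Bv' - Bv))\<^sup>2 - (norm (u' + Bv - b))\<^sup>2 - (norm (u' + Bv' - b))\<^sup>2) / 2"
proof -
  have x: "x = b - B\<xi>" using assms by (simp add: eq_diff_eq)
  show ?thesis
    unfolding x power2_norm_eq_inner by (simp add: inner_commute algebra_simps add_divide_distrib diff_divide_distrib)
qed

theorem lemma5p8:
  fixes f :: "real^'p \<Rightarrow> ereal" and g :: "real^'q \<Rightarrow> ereal"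
    and B :: "real^'q^'p" and b :: "real^'p"
    and \<sigma> \<rho> t \<alpha> :: real
  assumes "proper_ereal f" and "lsc_ereal f" and "convex_ereal f"
    and "proper_ereal g" and "lsc_ereal g"
    and "\<sigma> \<ge> 0" and "strongly_convex_ereal \<sigma> g"
    and "\<exists>z y. saddle_point (aug_lagrangian f g B b 0) z y"
    and "\<rho> > 0" and "t > 0" and "\<alpha> > 0"
    and "inverse \<alpha> > \<rho> * lambda_max (transpose B ** B)"
  shows "(\<forall>z y. \<exists>!z'. z' \<in> chambolle_pock f g B b \<sigma> \<rho> t \<alpha> z y)
    \<and> nice_primal_map f g B b \<sigma> \<rho> t (chambolle_pock f g B b \<sigma> \<rho> t \<alpha>)
        (1 - \<rho> * \<alpha> * lambda_max (transpose B ** B))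
        0 0 ((1 / \<alpha>) *\<^sub>R mat 1) 0"
proof -
  define \<tau> where "\<tau> = tau_t \<sigma> t"
  define r where "r = rho_t \<sigma> \<rho> t"
  define l where "l = lambda_max (transpose B ** B)"
  have \<tau>: "0 < \<tau>" and r_eq: "r = \<rho> * \<tau>"
    using \<open>t > 0\<close> by (auto simp: \<tau>_def r_def tau_t_def rho_t_def)
  have r: "0 < r" using \<tau> \<open>\<rho> > 0\<close> by (simp add: r_eq)
  have l: "0 \<le> l" "\<rho> * \<alpha> * l < 1"
    using assms(9,11,12) by (auto simp: l_def lambda_max_Gram_nonneg field_simps)

  define F where "F v y = (\<lambda>x. f x + ereal (y \<bullet> (x + B *v v - b)
      + r / 2 * (norm (x + B *v v - b))\<^sup>2))" for v y
  define G where "G v u' y = (\<lambda>x. g x + ereal (y \<bullet> (u' + B *v x - b)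
      + r * ((u' + B *v v - b) \<bullet> (B *v x)) + \<tau> / (2 * \<alpha>) * (norm (x - v))\<^sup>2))" for v u' y
  have cp: "(u', v') \<in> chambolle_pock f g B b \<sigma> \<rho> t \<alpha> (u, v) y \<longleftrightarrow>
      is_arg_min (F v y) (\<lambda>_. True) u' \<and> is_arg_min (G v u' y) (\<lambda>_. True) v'" for u v y u' v'
    by (simp add: chambolle_pock_def F_def G_def \<tau>_def r_def)

  \<comment> \<open>completed with an explicit centre \<open>b - B *v v\<close>, to match the general penalised step\<close>
  have F_eq: "F v y = (\<lambda>x. f x + ereal (y \<bullet> (x + B *v v - b)
      + r / 2 * (norm (x - (b - B *v v)))\<^sup>2))" for v y
    by (simp add: F_def algebra_simps)
  have F_affine: "y \<bullet> (s *\<^sub>R x + (1 - s) *\<^sub>R x' + e - b) =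
      s * (y \<bullet> (x + e - b)) + (1 - s) * (y \<bullet> (x' + e - b))" for y x x' e s
    by (simp add: algebra_simps)
  have F_cont: "continuous_on UNIV (\<lambda>x. y \<bullet> (x + e - b))" for y e
    by (intro continuous_intros)
  note F_argmin = argmin_penalised[OF assms(1,2) convex_imp_strongly_convex_ereal_0[OF assms(3)]
      order.refl r F_affine F_cont F_eq]

  have G_eq: "G v u' y = (\<lambda>x. g x + ereal ((y \<bullet> (u' + B *v x - b)
      + r * ((u' + B *v v - b) \<bullet> (B *v x))) + \<tau> / \<alpha> / 2 * (norm (x - v))\<^sup>2))" for v u' y
    by (simp add: G_def mult.commute)
  have G_affine: "y \<bullet> (u' + B *v (s *\<^sub>R x + (1 - s) *\<^sub>R x') - b)
        + r * (e \<bullet> (B *v (s *\<^sub>R x + (1 - s) *\<^sub>R x'))) =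
      s * (y \<bullet> (u' + B *v x - b) + r * (e \<bullet> (B *v x)))
      + (1 - s) * (y \<bullet> (u' + B *v x' - b) + r * (e \<bullet> (B *v x')))" for y u' e x x' s
    by (simp add: matrix_vector_right_distrib matrix_vector_mult_scaleR algebra_simps)
  have G_cont: "continuous_on UNIV (\<lambda>x. y \<bullet> (u' + B *v x - b) + r * (e \<bullet> (B *v x)))" for y u' e
    by (intro continuous_intros matrix_vector_mult_linear_continuous_on)
  have "0 < \<tau> / \<alpha>" using \<tau> \<open>\<alpha> > 0\<close> by simp
  note G_argmin = argmin_penalised[OF assms(4,5,7,6) this G_affine G_cont G_eq]

  have unique: "\<exists>!z'. z' \<in> chambolle_pock f g B b \<sigma> \<rho> t \<alpha> z y" for z y
  proof -
    obtain u v where z: "z = (u, v)" by (cases z)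
    obtain u' where u': "is_arg_min (F v y) (\<lambda>_. True) u'"
      "\<And>x. is_arg_min (F v y) (\<lambda>_. True) x \<Longrightarrow> x = u'"
      using F_argmin(1) by (metis (no_types))
    obtain v' where v': "is_arg_min (G v u' y) (\<lambda>_. True) v'"
      "\<And>x. is_arg_min (G v u' y) (\<lambda>_. True) x \<Longrightarrow> x = v'"
      using G_argmin(1) by (metis (no_types))
    show ?thesis
      unfolding z
    proof (rule ex1I)
      show "(u', v') \<in> chambolle_pock f g B b \<sigma> \<rho> t \<alpha> (u, v) y"
        using u'(1) v'(1) by (simp add: cp)
      fix z' assume z': "z' \<in> chambolle_pock f g B b \<sigma> \<rho> t \<alpha> (u, v) y"
      obtain x x' where "z' = (x, x')" by (cases z')
      with z' show "z' = (u', v')" using u'(2) v'(2) by (auto simp: cp)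
    qed
  qed

  have ineq: "aug_lagrangian f g B b r (u', v') y - aug_lagrangian f g B b r (\<xi>1, \<xi>2) y
      \<le> ereal (\<tau> * Delta ((1 / \<alpha>) *\<^sub>R mat 1) \<xi>2 v v' - \<sigma> / 2 * (norm (\<xi>2 - v'))\<^sup>2
          - (1 - \<rho> * \<alpha> * l) * r / 2 * (norm (Aop B (u', v') - b))\<^sup>2)" (is "?lhs \<le> ereal ?rhs")
    if mem: "(u', v') \<in> chambolle_pock f g B b \<sigma> \<rho> t \<alpha> (u, v) y"
      and feas: "(\<xi>1, \<xi>2) \<in> feasible B b" for u v y u' v' \<xi>1 \<xi>2
  proof -
    have u': "is_arg_min (F v y) (\<lambda>_. True) u'" and v': "is_arg_min (G v u' y) (\<lambda>_. True) v'"
      using mem by (auto simp: cp)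
    obtain fu gv where fu: "f u' = ereal fu" and gv: "g v' = ereal gv"
      using F_argmin(3)[OF u'] G_argmin(3)[OF v'] by (cases "f u'"; cases "g v'") auto
    have \<xi>: "\<xi>1 + B *v \<xi>2 = b"
      using feas by (simp add: feasible_def Aop_def)
    show ?thesis
    proof (cases "f \<xi>1 = \<infinity> \<or> g \<xi>2 = \<infinity>")
      case True
      \<comment> \<open>the Lagrangian at the iterate is finite, so the difference is \<open>-\<infinity>\<close>\<close>
      then have "Psi f g (\<xi>1, \<xi>2) = \<infinity>"
        using assms(1,4) by (auto simp: Psi_def proper_ereal_def)
      then show ?thesis by (simp add: aug_lagrangian_def Psi_def[of f g "(u', v')"] fu gv)
    next
      case False
      then obtain fx gx where fx: "f \<xi>1 = ereal fx" and gx: "g \<xi>2 = ereal gx"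
        using assms(1,4) unfolding proper_ereal_def by (metis ereal_cases)
      have growth_f: "fu + (y \<bullet> (u' + B *v v - b) + r / 2 * (norm (u' + B *v v - b))\<^sup>2)
          + r / 2 * (norm (\<xi>1 - u'))\<^sup>2
        \<le> fx + (y \<bullet> (\<xi>1 + B *v v - b) + r / 2 * (norm (\<xi>1 + B *v v - b))\<^sup>2)"
        using F_argmin(2)[OF u', of \<xi>1] by (simp add: F_def fu fx)
      have growth_g: "gv + (y \<bullet> (u' + B *v v' - b) + r * ((u' + B *v v - b) \<bullet> (B *v v'))
            + \<tau> / (2 * \<alpha>) * (norm (v' - v))\<^sup>2) + (\<sigma> + \<tau> / \<alpha>) / 2 * (norm (\<xi>2 - v'))\<^sup>2
        \<le> gx + (y \<bullet> (u' + B *v \<xi>2 - b) + r * ((u' + B *v v - b) \<bullet> (B *v \<xi>2))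
            + \<tau> / (2 * \<alpha>) * (norm (\<xi>2 - v))\<^sup>2)"
        using G_argmin(2)[OF v', of \<xi>2] by (simp add: G_def gv gx)
      \<comment> \<open>the multiplier terms on the two right-hand sides add up to the one on the left of
        \<open>growth_f\<close>, so that only the one at the new iterate survives\<close>
      have multiplier: "y \<bullet> (\<xi>1 + B *v v - b) + y \<bullet> (u' + B *v \<xi>2 - b) - y \<bullet> (u' + B *v v - b) = 0"
        unfolding \<xi>[symmetric] by (simp add: algebra_simps)
      have collapse: "r * (((norm (\<xi>1 + B *v v - b))\<^sup>2 - (norm (u' + B *v v - b))\<^sup>2
            - (norm (\<xi>1 - u'))\<^sup>2) / 2 + (u' + B *v v - b) \<bullet> (B *v \<xi>2 - B *v v'))
        = r * (((norm (B *v v' - B *v v))\<^sup>2 - (norm (u' + B *v v - b))\<^sup>2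
            - (norm (u' + B *v v' - b))\<^sup>2) / 2)"
        by (simp only: penalty_terms_collapse[OF \<xi>])
      have "(norm (B *v v' - B *v v))\<^sup>2 \<le> l * (norm (v' - v))\<^sup>2"
        using norm_matrix_vector_le_lambda_max[of B "v' - v"]
        by (simp add: l_def matrix_vector_mult_diff_distrib)
      then have "(1 - \<rho> * \<alpha> * l) * (norm (u' + B *v v - b + (B *v v' - B *v v)))\<^sup>2
          \<le> (norm (u' + B *v v - b))\<^sup>2 - (norm (B *v v' - B *v v))\<^sup>2
            + (norm (v' - v))\<^sup>2 / (\<rho> * \<alpha>)"
        using l(1) assms(9,11) by (intro residual_estimate) auto
      then have "r / 2 * ((1 - \<rho> * \<alpha> * l) * (norm (u' + B *v v' - b))\<^sup>2)
          \<le> r / 2 * ((norm (u' + B *v v - b))\<^sup>2 - (norm (B *v v' - B *v v))\<^sup>2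
            + (norm (v' - v))\<^sup>2 / (\<rho> * \<alpha>))"
        using r by (intro mult_left_mono) (auto simp: algebra_simps)
      moreover have "r / 2 * ((norm (v' - v))\<^sup>2 / (\<rho> * \<alpha>)) = \<tau> / (2 * \<alpha>) * (norm (v' - v))\<^sup>2"
        using assms(9) by (simp add: r_eq)
      ultimately have residual: "r / 2 * ((1 - \<rho> * \<alpha> * l) * (norm (u' + B *v v' - b))\<^sup>2)
          \<le> r / 2 * ((norm (u' + B *v v - b))\<^sup>2 - (norm (B *v v' - B *v v))\<^sup>2)
            + \<tau> / (2 * \<alpha>) * (norm (v' - v))\<^sup>2"
        by (simp only: distrib_left)
      have Delta_eq: "\<tau> * Delta ((1 / \<alpha>) *\<^sub>R mat 1) \<xi>2 v v'
          = \<tau> / (2 * \<alpha>) * (norm (\<xi>2 - v))\<^sup>2 - \<tau> / (2 * \<alpha>) * (norm (\<xi>2 - v'))\<^sup>2"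
        using assms(11) by (simp add: Delta_def norm_mat_scaled_id field_simps)
      have "(fu + gv + (y \<bullet> (u' + B *v v' - b) + r / 2 * (norm (u' + B *v v' - b))\<^sup>2)) - (fx + gx)
          \<le> \<tau> * Delta ((1 / \<alpha>) *\<^sub>R mat 1) \<xi>2 v v' - \<sigma> / 2 * (norm (\<xi>2 - v'))\<^sup>2
            - r / 2 * ((1 - \<rho> * \<alpha> * l) * (norm (u' + B *v v' - b))\<^sup>2)"
        using growth_f growth_g multiplier collapse residual unfolding Delta_eq
        by (simp add: inner_diff_right distrib_left right_diff_distrib distrib_right
            add_divide_distrib diff_divide_distrib)
      then show ?thesis
        by (simp add: aug_lagrangian_def Psi_def Aop_def fu gv fx gx \<xi> algebra_simps
            add_divide_distrib diff_divide_distrib)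
    qed
  qed

  have "nice_primal_map f g B b \<sigma> \<rho> t (chambolle_pock f g B b \<sigma> \<rho> t \<alpha>)
      (1 - \<rho> * \<alpha> * l) 0 0 ((1 / \<alpha>) *\<^sub>R mat 1) 0"
    unfolding nice_primal_map_def
  proof (intro conjI allI impI)
    show "psd (0 :: real^'p^'p)" "psd (0 :: real^'p^'p)" "psd (0 :: real^'q^'q)"
      using psd_scaled_id[of 0] by simp_all
    show "psd ((1 / \<alpha>) *\<^sub>R mat 1 :: real^'q^'q)" using assms(11) by (intro psd_scaled_id) simp
  qed (use l assms(9,11) ineq[unfolded r_def \<tau>_def] in \<open>auto simp: norm_mat_zero Delta_def[of 0]\<close>)
  then show ?thesis using unique by (simp add: l_def)
qed

end
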